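(* Let $k\geq 2$ and $n>2(k+2)^4$ be integers. Let $G$ be a (simple, finite) graph of order $n$ whose spectral radius satisfies $\mu(G)\geq \mu(S_{n,k})$. Then $G$ contains every tree $T$ of order $2k+2$ with $\operatorname{diam}(T)\le 4$ as a subgraph, unless $G\cong S_{n,k}$.
   Context: For a graph $G$, $\mu(G)$ denotes the largest eigenvalue of its adjacency matrix. $S_{n,k}=K_k\vee \overline{K_{n-k}}$ is the join of a complete graph on $k$ vertices and an empty (edgeless) graph on $n-k$ vertices, i.e. every vertex of the $K_k$ is joined to every vertex of the independent set of size $n-k$. $\operatorname{diam}(T)$ denotes the diameter of $T$. *)

theory Defs
  imports
    "Graph_Theory.Graph_Theory"
    "Jordan_Normal_Form.Spectral_Radius"
begin

text \<open>
  Finite simple graphs are the \<open>pair_graph\<close>s of the Graph Theory library: finite loopless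
  digraphs with a symmetric set of arcs, an edge \<open>{u, v}\<close> being the two arcs \<open>(u, v)\<close> and
  \<open>(v, u)\<close>.
\<close>

text \<open>
  The rows and columns are indexed by an arbitrarily chosen enumeration of the vertices.
  Another choice conjugates the matrix by a permutation matrix, so the spectrum does not
  depend on it.
\<close>

definition vertex_enum :: "'a pair_pre_digraph \<Rightarrow> 'a list" where
  "vertex_enum G = (SOME vs. distinct vs \<and> set vs = pverts G)"

definition adjacency_matrix :: "'a pair_pre_digraph \<Rightarrow> real mat" where
  "adjacency_matrix G =
     mat (card (pverts G)) (card (pverts G))
       (\<lambda>(i, j). if (vertex_enum G ! i, vertex_enum G ! j) \<in> parcs G then 1 else 0)"

text \<open>
  The adjacency matrix of a simple graph is real symmetric, so its complex eigenvalues are all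
  real and the maximum of the real spectrum is the maximum over all eigenvalues. It is
  meaningful only for graphs with at least one vertex, as otherwise the spectrum is empty.
\<close>

definition largest_eigenvalue :: "'a pair_pre_digraph \<Rightarrow> real" where
  "largest_eigenvalue G = Max (spectrum (adjacency_matrix G))"

definition complete_graph :: "'a set \<Rightarrow> 'a pair_pre_digraph" where
  "complete_graph V = \<lparr>pverts = V, parcs = {(u, v). u \<in> V \<and> v \<in> V \<and> u \<noteq> v}\<rparr>"

definition edgeless_graph :: "'a set \<Rightarrow> 'a pair_pre_digraph" where
  "edgeless_graph V = \<lparr>pverts = V, parcs = {}\<rparr>"

definition graph_join ::
    "'a pair_pre_digraph \<Rightarrow> 'b pair_pre_digraph \<Rightarrow> ('a + 'b) pair_pre_digraph" where
  "graph_join G H =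
     \<lparr>pverts = pverts G <+> pverts H,
      parcs = {(Inl u, Inl v) | u v. (u, v) \<in> parcs G}
            \<union> {(Inr u, Inr v) | u v. (u, v) \<in> parcs H}
            \<union> {(Inl u, Inr v) | u v. u \<in> pverts G \<and> v \<in> pverts H}
            \<union> {(Inr v, Inl u) | u v. u \<in> pverts G \<and> v \<in> pverts H}\<rparr>"

definition S_graph :: "nat \<Rightarrow> nat \<Rightarrow> (nat + nat) pair_pre_digraph" where
  "S_graph n k = graph_join (complete_graph {..<k}) (edgeless_graph {..<n - k})"

text \<open>
  The library's \<open>forest\<close> and \<open>tree\<close> are unusable for symmetric digraphs, since there the
  closed walk \<open>u, v, u\<close> along a single edge counts as a \<open>cycle\<close>. In a loopless
  \<open>pair_graph\<close> the cycles with at least three arcs are the cycles of the undirected graph.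
\<close>

definition undirected_tree :: "'a pair_pre_digraph \<Rightarrow> bool" where
  "undirected_tree T \<longleftrightarrow>
     pair_graph T \<and> connected T \<and> \<not> (\<exists>p. pre_digraph.cycle T p \<and> length p \<ge> 3)"

text \<open>
  \<open>wf_digraph.\<mu> T (\<lambda>_. 1) u v\<close> is the least number of arcs of a walk from \<open>u\<close> to \<open>v\<close>
  (infinite if there is none). The diameter is meant for graphs with at least one vertex.
\<close>

definition graph_distance :: "'a pair_pre_digraph \<Rightarrow> 'a \<Rightarrow> 'a \<Rightarrow> ereal" where
  "graph_distance G u v = wf_digraph.\<mu> G (\<lambda>_. 1) u v"

definition diam :: "'a pair_pre_digraph \<Rightarrow> ereal" where
  "diam G = (SUP u\<in>pverts G. SUP v\<in>pverts G. graph_distance G u v)"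

text \<open>Containment as a not necessarily induced subgraph, up to isomorphism.\<close>

definition contains_subgraph :: "'a pair_pre_digraph \<Rightarrow> 'b pair_pre_digraph \<Rightarrow> bool" where
  "contains_subgraph G T \<longleftrightarrow>
     (\<exists>H :: 'a pair_pre_digraph. subgraph H G \<and> digraph_iso T H)"

end

theory Submission
  imports Defs
begin

text \<open>
  A tree of diameter at most 4 consists of a centre \<open>c\<close>, its neighbours \<open>A\<close> and the remaining
  vertices \<open>B\<close>, each attached to a parent \<open>p b\<close> in \<open>A\<close>. Call a vertex of \<open>G\<close> heavy if its degree
  is at least \<open>2 k + 1\<close>, which is enough to attach the leaves of the tree greedily. If \<open>G\<close> does
  not contain the tree, greedy embeddings restrict the numbers of heavy neighbours: if \<open>\<bar>A\<bar> \<le> k\<close>,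
  every vertex has fewer than \<open>\<bar>A\<bar>\<close> of them; otherwise \<open>\<bar>B\<bar> \<le> k\<close>, a heavy vertex \<open>u\<close> has fewer than
  \<open>\<bar>p ` B\<bar> \<le> k\<close> heavy neighbours, and almost all light neighbours of \<open>u\<close> have degree at most \<open>k\<close>.

  Let \<open>l\<close> be the largest eigenvalue and \<open>y\<close> the vector of absolute values of an eigenvector, scaled
  to have maximum \<open>y u = 1\<close>, so that \<open>l y\<close> is at most the sum of \<open>y\<close> over the neighbours. Applying
  this inequality twice at \<open>u\<close> and comparing with \<open>l\<^sup>2 \<ge> (k - 1) l + k (n - k)\<close>, which is an equality
  for \<open>S\<^bsub>n,k\<^esub>\<close>, forces \<open>u\<close> to have exactly \<open>k - 1\<close> heavy neighbours. The tree is then a spider with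
  \<open>k\<close> legs of length 2 and one leg of length 1, a further embedding shows that the light neighbours
  of \<open>u\<close> are adjacent only to \<open>u\<close> and its heavy neighbours, and equality throughout gives \<open>S\<^bsub>n,k\<^esub>\<close>.
\<close>

section \<open>Trees of diameter at most four\<close>

text \<open>
  Walks that never backtrack along the arc just used. In a graph without cycles they are paths, and
  there is at most one between two given vertices.
\<close>

primrec nb_walk :: "'a rel \<Rightarrow> 'a list \<Rightarrow> bool" where
  "nb_walk E [] \<longleftrightarrow> True"
| "nb_walk E (x # xs) \<longleftrightarrow> nb_walk E xs \<and>
     (\<forall>y ys. xs = y # ys \<longrightarrow> (x, y) \<in> E \<and> (\<forall>z zs. ys = z # zs \<longrightarrow> z \<noteq> x))"

text \<open>Walks leaving \<open>x\<close> by different first steps glue to one walk through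
  \<open>x\<close>. \<open>take 1\<close> makes that condition vacuous if one of them is
  trivial.\<close>

lemma nb_walk_rev_append:
  assumes "sym E" "nb_walk E (x # xs)" "nb_walk E (x # ys)"
    and "\<And>y z. y \<in> set (take 1 xs) \<Longrightarrow> z \<in> set (take 1 ys) \<Longrightarrow> y \<noteq> z"
  shows "nb_walk E (rev xs @ x # ys)"
  using assms(2-)
proof (induction xs arbitrary: x ys)
  case Nil
  then show ?case by simp
next
  case (Cons b xs)
  have "nb_walk E (rev xs @ b # (x # ys))"
  proof (rule Cons.IH)
    show "nb_walk E (b # xs)" using Cons.prems by simp
    show "nb_walk E (b # x # ys)"
      using Cons.prems(1,2) Cons.prems(3)[of b] symD[OF assms(1)] by (cases ys) auto
    show "\<And>y z. y \<in> set (take 1 xs) \<Longrightarrow> z \<in> set (take 1 (x # ys)) \<Longrightarrow> y \<noteq> z"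
      using Cons.prems(1) by (cases xs) auto
  qed
  then show ?case by simp
qed

lemma nb_walk_appendD: "nb_walk E (xs @ ys) \<Longrightarrow> nb_walk E xs \<and> nb_walk E ys"
proof (induction xs)
  case (Cons x xs)
  then show ?case by (cases xs; cases "tl xs") auto
qed simp

lemma nb_walk_arcs: "nb_walk E xs \<Longrightarrow> set (vwalk_arcs xs) \<subseteq> E"
  by (induction xs rule: vwalk_arcs.induct) auto

lemma pcas_vwalk_arcs: "xs \<noteq> [] \<Longrightarrow> pcas (hd xs) (vwalk_arcs xs) (last xs)"
  by (induction xs rule: vwalk_arcs.induct) auto

lemma pawalk_verts_vwalk_arcs: "xs \<noteq> [] \<Longrightarrow> pawalk_verts (hd xs) (vwalk_arcs xs) = xs"
  by (induction xs rule: vwalk_arcs.induct) auto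

section \<open>Paths and the centre of a tree\<close>

text \<open>Since \<open>x, y, x\<close> is not an \<open>nb_walk\<close>, \<open>acyclic_E\<close>
  excludes only loops and undirected cycles of length at least 3.\<close>

locale tree_diam_le_4 =
  fixes V :: "'a set" and E :: "'a rel"
  assumes V_nonempty: "V \<noteq> {}"
    and E_V: "E \<subseteq> V \<times> V"
    and sym_E: "sym E"
    and irrefl_E: "irrefl E"
    and acyclic_E: "\<And>x xs. nb_walk E (x # xs @ [x]) \<Longrightarrow> distinct (x # xs) \<Longrightarrow> False"
    and distance_le_4: "\<And>x y. x \<in> V \<Longrightarrow> y \<in> V \<Longrightarrow>
           \<exists>p. pcas x p y \<and> set p \<subseteq> E \<and> length p \<le> 4"
begin

text \<open>The tail is distinct by induction, so a first return to the head would close a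
  cycle.\<close>

lemma nb_walk_distinct: "nb_walk E xs \<Longrightarrow> distinct xs"
proof (induction xs)
  case (Cons a xs)
  then have d: "distinct xs" by simp
  have "a \<notin> set xs"
  proof
    assume "a \<in> set xs"
    then obtain us vs where xs: "xs = us @ a # vs" by (meson split_list)
    have "nb_walk E ((a # us @ [a]) @ vs)" using Cons.prems xs by simp
    then have "nb_walk E (a # us @ [a])" using nb_walk_appendD by blast
    moreover have "distinct (a # us)" using d xs by auto
    ultimately show False by (rule acyclic_E)
  qed
  with d show ?case by simp
qed simp

text \<open>Where two walks to the same vertex diverge, reversing one and appending the other gives
  an \<open>nb_walk\<close>; it is distinct, yet it meets the common end twice.\<close>

lemma nb_walk_unique:
  "nb_walk E (a # xs) \<Longrightarrow> nb_walk E (a # ys) \<Longrightarrow> last (a # xs) = last (a # ys) \<Longrightarrow> xs = ys"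
proof (induction xs arbitrary: a ys)
  case Nil
  then show ?case using nb_walk_distinct[OF Nil.prems(2)] by (cases ys) (auto split: if_splits)
next
  case (Cons b xs)
  show ?case
  proof (cases ys)
    case ys: Nil
    with Cons.prems nb_walk_distinct[OF Cons.prems(1)] show ?thesis by (auto split: if_splits)
  next
    case ys: (Cons b' ys')
    show ?thesis
    proof (cases "b = b'")
      case True
      then show ?thesis using Cons.IH[of b ys'] Cons.prems ys by auto
    next
      case False
      then have "nb_walk E (rev (b # xs) @ a # ys)"
        using Cons.prems ys by (intro nb_walk_rev_append sym_E) auto
      then have "distinct (rev (b # xs) @ a # ys)" by (rule nb_walk_distinct)
      moreover have "last (b # xs) = last ys" using Cons.prems(3) ys by auto
      then have "last ys \<in> set (b # xs)" by (metis last_in_set list.discI)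
      moreover have "last ys \<in> set ys" using ys by (intro last_in_set) simp
      ultimately show ?thesis by auto
    qed
  qed
qed

text \<open>If the reduced rest of the walk returns to \<open>x\<close> at once, both steps are
  dropped, so reduction never lengthens a walk.\<close>

lemma walk_imp_nb_walk:
  "pcas x p y \<Longrightarrow> set p \<subseteq> E \<Longrightarrow>
     \<exists>xs. nb_walk E (x # xs) \<and> last (x # xs) = y \<and> length xs \<le> length p"
proof (induction p arbitrary: x)
  case Nil
  then show ?case by (intro exI[of _ "[]"]) auto
next
  case (Cons e p)
  obtain b where e: "e = (x, b)" using Cons.prems by (cases e) auto
  then obtain xs where xs: "nb_walk E (b # xs)" "last (b # xs) = y" "length xs \<le> length p"
    using Cons by fastforce
  show ?case
  proof (cases "\<exists>zs. xs = x # zs")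
    case True
    then obtain zs where "xs = x # zs" by blast
    then show ?thesis using xs by (intro exI[of _ zs]) auto
  next
    case False
    then have "nb_walk E (x # b # xs)" using xs(1) e Cons.prems(2) by auto
    then show ?thesis using xs by (intro exI[of _ "b # xs"]) auto
  qed
qed

lemma nb_walk_length_le:
  assumes "nb_walk E (x # xs)" "x \<in> V"
  shows "length xs \<le> 4"
proof -
  have "set (x # xs) \<subseteq> V"
    using assms E_V
  proof (induction xs arbitrary: x)
    case (Cons b xs)
    then show ?case by (cases xs) auto
  qed simp
  then have "last (x # xs) \<in> V" by (metis last_in_set list.discI subsetD)
  from distance_le_4[OF assms(2) this] obtain p
    where "pcas x p (last (x # xs))" "set p \<subseteq> E" "length p \<le> 4" by blast
  then show ?thesis using walk_imp_nb_walk nb_walk_unique[OF assms(1)] by (metis le_trans)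
qed

text \<open>The middle of a longest path is a centre: a walk from \<open>c\<close> differs from one
  of the two halves in its first step, and glued to that half it cannot exceed the longest
  path.\<close>

lemma ex_center: "\<exists>c\<in>V. \<forall>w\<in>V. \<exists>xs. nb_walk E (c # xs) \<and> last (c # xs) = w \<and> length xs \<le> 2"
proof -
  define P where "P xs \<longleftrightarrow> nb_walk E xs \<and> set xs \<subseteq> V \<and> xs \<noteq> []" for xs
  have le5: "length xs \<le> 5" if "P xs" for xs
    using that nb_walk_length_le by (cases xs) (auto simp: P_def)
  obtain v where "v \<in> V" using V_nonempty by blast
  then have "P [v]" by (simp add: P_def)
  then obtain p where p: "P p" and max: "\<And>q. P q \<Longrightarrow> length q \<le> length p"
    using ex_has_greatest_nat[of P "[v]" length 6] le5 by force
  \<comment> \<open>As \<open>p\<close> has at most 5 vertices, each half beside \<open>c\<close>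
    has at most 2.\<close>
  define xs c ys where "xs = take (length p div 2) p" and "c = p ! (length p div 2)"
    and "ys = drop (Suc (length p div 2)) p"
  have "p \<noteq> []" using p by (simp add: P_def)
  then have split: "p = xs @ c # ys" unfolding xs_def c_def ys_def
    by (intro id_take_nth_drop) (cases p, auto)
  have len: "length xs = length p div 2" "length ys = length p - 1 - length p div 2"
    using \<open>p \<noteq> []\<close> by (cases p; auto simp: xs_def ys_def)+
  have nb: "nb_walk E (xs @ c # ys)" and sub: "set (xs @ c # ys) \<subseteq> V" and c: "c \<in> V"
    using p split by (auto simp: P_def)
  have nbr: "nb_walk E (c # ys)" using nb nb_walk_appendD by blast
  have nbl: "nb_walk E (c # rev xs)"
  proof -
    have "nb_walk E (xs @ [c])" using nb nb_walk_appendD[of E "xs @ [c]" ys] by simp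
    then have "nb_walk E (rev (xs @ [c]))"
    proof -
      have *: "nb_walk E (rev q)" if "nb_walk E q" for q
        using that nb_walk_rev_append[OF sym_E, of "hd q" "tl q" "[]"] by (cases q) auto
      show ?thesis by (rule *) fact
    qed
    then show ?thesis by simp
  qed
  have "\<exists>zs. nb_walk E (c # zs) \<and> last (c # zs) = w \<and> length zs \<le> 2" if w: "w \<in> V" for w
  proof -
    obtain zs where zs: "nb_walk E (c # zs)" "last (c # zs) = w"
      using distance_le_4[OF c w] walk_imp_nb_walk by blast
    have zsV: "set zs \<subseteq> V"
    proof -
      have "set (vwalk_arcs (c # zs)) \<subseteq> E" using zs(1) by (rule nb_walk_arcs)
      then show ?thesis using E_V by (induction zs arbitrary: c) auto
    qed
    have key: "length zs + length q \<le> length p - 1"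
      if q: "nb_walk E (c # q)" "set q \<subseteq> V" "\<And>y z. y \<in> set (take 1 zs) \<Longrightarrow> z \<in> set (take 1 q) \<Longrightarrow> y \<noteq> z" for q
    proof -
      have "nb_walk E (rev zs @ c # q)" by (rule nb_walk_rev_append[OF sym_E zs(1) q(1) q(3)])
      then have "P (rev zs @ c # q)" using zsV q(2) c by (auto simp: P_def)
      from max[OF this] show ?thesis by simp
    qed
    \<comment> \<open>The two halves start with different neighbours of \<open>c\<close>, and
      \<open>zs\<close> can start with only one of them.\<close>
    have "(\<forall>y z. y \<in> set (take 1 zs) \<longrightarrow> z \<in> set (take 1 ys) \<longrightarrow> y \<noteq> z) \<or>
          (\<forall>y z. y \<in> set (take 1 zs) \<longrightarrow> z \<in> set (take 1 (rev xs)) \<longrightarrow> y \<noteq> z)"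
    proof (cases zs)
      case zs: (Cons a zs')
      show ?thesis
      proof (cases ys)
        case ys: (Cons b ys')
        have "distinct (xs @ c # ys)" using nb by (rule nb_walk_distinct)
        then have "b \<notin> set (take 1 (rev xs))" using ys set_take_subset[of 1 "rev xs"] by auto
        then show ?thesis using ys zs by auto
      qed auto
    qed auto
    then have "length zs + length ys \<le> length p - 1 \<or> length zs + length (rev xs) \<le> length p - 1"
      using key[OF nbr] key[OF nbl] sub by auto
    then have "length zs \<le> 2" using len le5[OF p] by auto
    with zs show ?thesis by blast
  qed
  with c show ?thesis by blast
qed

text \<open>\<open>A\<close> is the neighbourhood of the centre. An edge inside \<open>A\<close> or
  inside \<open>B\<close>, or a second parent, would give two different \<open>nb_walk\<close>s from
  \<open>c\<close> to one vertex.\<close>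

lemma ex_two_levels:
  obtains c A B p where "V = insert c (A \<union> B)" "c \<notin> A" "c \<notin> B" "A \<inter> B = {}" "p ` B \<subseteq> A"
    "E = {(c, a) | a. a \<in> A} \<union> {(a, c) | a. a \<in> A} \<union> {(p b, b) | b. b \<in> B} \<union> {(b, p b) | b. b \<in> B}"
proof -
  obtain c where c: "c \<in> V"
    and near: "\<And>w. w \<in> V \<Longrightarrow> \<exists>xs. nb_walk E (c # xs) \<and> last (c # xs) = w \<and> length xs \<le> 2"
    using ex_center by blast
  define A where "A = {a. (c, a) \<in> E}"
  define B where "B = V - insert c A"
  have noloop: "(x, x) \<notin> E" for x using irrefl_E by (auto simp: irrefl_def)
  have symE: "(x, y) \<in> E \<Longrightarrow> (y, x) \<in> E" for x y using sym_E by (rule symD)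
  have par: "\<exists>a. a \<in> A \<and> (a, b) \<in> E" if b: "b \<in> B" for b
  proof -
    obtain xs where xs: "nb_walk E (c # xs)" "last (c # xs) = b" "length xs \<le> 2"
      using near b B_def by blast
    then consider "xs = []" | x where "xs = [x]" | x y where "xs = [x, y]"
      by (auto simp: le_Suc_eq length_Suc_conv numeral_2_eq_2)
    then show ?thesis using xs b by cases (auto simp: A_def B_def)
  qed
  define p where "p b = (SOME a. a \<in> A \<and> (a, b) \<in> E)" for b
  have p: "p b \<in> A" "(p b, b) \<in> E" if "b \<in> B" for b
    using someI_ex[OF par[OF that]] by (auto simp: p_def)
  have cA: "c \<notin> A" using noloop by (auto simp: A_def)
  have AB: "A \<inter> B = {}" "c \<notin> B" by (auto simp: B_def)
  have w2: "nb_walk E [c, a, b]" if "a \<in> A" "(a, b) \<in> E" "b \<noteq> c" for a b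
    using that by (auto simp: A_def)
  have uniq: "xs = ys" if "nb_walk E (c # xs)" "nb_walk E (c # ys)" "last (c # xs) = last (c # ys)" for xs ys
    using that by (rule nb_walk_unique)
  have nAA: "(x, y) \<notin> E" if "x \<in> A" "y \<in> A" for x y
    using uniq[of "[x, y]" "[y]"] w2[of x y] that cA by (auto simp: A_def)
  have nAB: "x = p y" if "x \<in> A" "y \<in> B" "(x, y) \<in> E" for x y
    using uniq[of "[x, y]" "[p y, y]"] w2[of x y] w2[of "p y" y] p that AB by auto
  have nBB: "(x, y) \<notin> E" if "x \<in> B" "y \<in> B" for x y
  proof
    assume "(x, y) \<in> E"
    moreover have "nb_walk E [c, p x, x]" "nb_walk E [c, p y, y]" using w2 p that AB by metis+
    moreover have "p x \<noteq> y" using p that AB by auto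
    ultimately have "nb_walk E [c, p x, x, y]" by simp
    then show False using uniq[of "[p x, x, y]" "[p y, y]"] \<open>nb_walk E [c, p y, y]\<close> by simp
  qed
  show thesis
  proof (rule that[of c A B p])
    show V: "V = insert c (A \<union> B)" using c E_V by (auto simp: A_def B_def)
    show "E = {(c, a) | a. a \<in> A} \<union> {(a, c) | a. a \<in> A} \<union> {(p b, b) | b. b \<in> B} \<union> {(b, p b) | b. b \<in> B}"
      (is "_ = ?R")
    proof
      show "?R \<subseteq> E" using p symE by (auto simp: A_def)
      show "E \<subseteq> ?R"
      proof
        fix e assume e: "e \<in> E"
        obtain x y where xy: "e = (x, y)" by fastforce
        then have "x \<in> V" "y \<in> V" "(x, y) \<in> E" "(y, x) \<in> E" using e E_V symE by auto
        then show "e \<in> ?R" using nAA[of x y] nAB[of x y] nAB[of y x] nBB[of x y] noloop xy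
          unfolding V by (auto simp: A_def) 
      qed
    qed
  qed (use cA AB p in auto)
qed

end

section \<open>The two-level form of an \<open>undirected_tree\<close>\<close>

lemma undirected_tree_two_levels:
  fixes T :: "'b pair_pre_digraph"
  assumes "undirected_tree T" "diam T \<le> 4"
  obtains c A B p where "pverts T = insert c (A \<union> B)" "c \<notin> A" "c \<notin> B" "A \<inter> B = {}" "p ` B \<subseteq> A"
    "parcs T = {(c, a) | a. a \<in> A} \<union> {(a, c) | a. a \<in> A} \<union> {(p b, b) | b. b \<in> B} \<union> {(b, p b) | b. b \<in> B}"
proof -
  have pg: "pair_graph T" and con: "connected T"
    and nocyc: "\<And>p. pre_digraph.cycle T p \<Longrightarrow> length p < 3"
    using assms(1) unfolding undirected_tree_def by force+
  interpret pair_graph T by (rule pg)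
  have irr: "irrefl (parcs T)" using pair_no_loops by (force simp: irrefl_def)
  have sy: "sym (parcs T)" using pair_sym_arcs unfolding symmetric_def by simp
  have "tree_diam_le_4 (pverts T) (parcs T)"
  proof
    show "pverts T \<noteq> {}" using con by (auto simp: connected_def strongly_connected_def mk_symmetric_def)
    show "parcs T \<subseteq> pverts T \<times> pverts T" using wellformed' by auto
    show "sym (parcs T)" "irrefl (parcs T)" by fact+
    show False if w: "nb_walk (parcs T) (x # xs @ [x])" and d: "distinct (x # xs)" for x xs
    proof -
      let ?p = "vwalk_arcs (x # xs @ [x])"
      have arcs: "set ?p \<subseteq> parcs T" using w by (rule nb_walk_arcs)
      \<comment> \<open>Shorter closed walks are loops or backtrack; three arcs are what
        \<open>nocyc\<close> asks for.\<close>
      have xs2: "length xs \<ge> 2"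
      proof (rule ccontr)
        assume "\<not> ?thesis"
        then consider "xs = []" | y where "xs = [y]" by (cases xs; cases "tl xs") auto
        then show False using w irr by cases (auto simp: irrefl_def)
      qed
      have len: "length ?p = length xs + 1" 
        using vwalk_length_simp[of "x # xs @ [x]"] unfolding vwalk_length_def by simp
      have "x \<in> pverts T" using arcs len xs2 wellformed' by (cases xs) auto
      then have "awalk x ?p x" using pcas_vwalk_arcs[of "x # xs @ [x]"] arcs
        by (auto simp: awalk_def)
      moreover have "pawalk_verts x ?p = x # xs @ [x]" using pawalk_verts_vwalk_arcs[of "x # xs @ [x]"] by simp
      ultimately have "cycle ?p" using d len by (force simp: cycle_def)
      from nocyc[OF this] len xs2 show False by simp
    qed
    show "\<exists>p. pcas x p y \<and> set p \<subseteq> parcs T \<and> length p \<le> 4" if "x \<in> pverts T" "y \<in> pverts T" for x y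
    proof -
      have "graph_distance T x y \<le> diam T" unfolding diam_def
        using that by (meson SUP_upper2 order_refl)
      then have "\<mu> (\<lambda>_. 1) x y \<le> 4" using assms(2) by (simp add: graph_distance_def)
      \<comment> \<open>Relaxing to a strict bound yields a walk of cost below 5 from the infimum;
        its cost is its length, an integer.\<close>
      then have "(INF p\<in>{p. awalk x p y}. ereal (awalk_cost (\<lambda>_. 1) p)) < 5"
        unfolding \<mu>_def by (rule le_less_trans) simp
      then obtain p where p: "awalk x p y" "ereal (awalk_cost (\<lambda>_. 1) p) < 5"
        by (auto simp: INF_less_iff)
      have "awalk_cost (\<lambda>_. 1) p = length p" by (induction p) (auto simp: awalk_cost_def)
      then have "length p \<le> 4" using p(2) by simp
      then show ?thesis using p(1) by (auto simp: awalk_def)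
    qed
  qed
  then interpret T: tree_diam_le_4 "pverts T" "parcs T" .
  from T.ex_two_levels that show thesis by blast
qed

section \<open>Greedy embeddings and the counting argument\<close>

text \<open>Each choice removes at most one element from every remaining set, so sets of
  \<open>card B\<close> elements never run out.\<close>

lemma ex_inj_choice:
  assumes "finite B" "\<And>b. b \<in> B \<Longrightarrow> card B \<le> card (F b)"
  shows "\<exists>h. inj_on h B \<and> (\<forall>b\<in>B. h b \<in> F b)"
  using assms
proof (induction B arbitrary: F rule: finite_induct)
  case empty
  then show ?case by simp
next
  case (insert x B)
  have "card (F x) > 0" using insert.prems[of x] insert.hyps by simp
  then obtain z where z: "z \<in> F x" by fastforce
  have "card B \<le> card (F b - {z})" if "b \<in> B" for b
    using insert.prems[of b] insert.hyps that by (cases "z \<in> F b") auto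
  from insert.IH[of "\<lambda>b. F b - {z}", OF this] obtain h where "inj_on h B" "\<forall>b\<in>B. h b \<in> F b - {z}" by blast
  with z insert.hyps show ?case
    by (intro exI[of _ "h(x := z)"]) (auto simp: inj_on_def)
qed

text \<open>Choosing for \<open>b0\<close> first lets one set be as small as a singleton.\<close>

lemma ex_inj_choice_but_one:
  assumes "finite B" "b0 \<in> B" "F b0 \<noteq> {}" "\<And>b. b \<in> B - {b0} \<Longrightarrow> card B \<le> card (F b)"
  shows "\<exists>h. inj_on h B \<and> (\<forall>b\<in>B. h b \<in> F b)"
proof -
  obtain z where z: "z \<in> F b0" using assms(3) by blast
  have "card (B - {b0}) \<le> card (F b - {z})" if "b \<in> B - {b0}" for b
    using assms(4)[OF that] assms(1,2) by (cases "z \<in> F b") auto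
  from ex_inj_choice[of "B - {b0}" "\<lambda>b. F b - {z}", OF _ this] obtain h where "inj_on h (B - {b0})" "\<forall>b\<in>B - {b0}. h b \<in> F b - {z}"
    using assms(1) by blast
  with z show ?thesis
    by (intro exI[of _ "h(b0 := z)"]) (auto simp: inj_on_def)
qed

text \<open>Each pick discards a vertex and its neighbours, at most \<open>Suc D\<close> vertices,
  so a vertex is left after \<open>m\<close> picks.\<close>

lemma ex_independent_subset:
  assumes "sym E" "irrefl E" "finite P"
    and "\<And>v. v \<in> P \<Longrightarrow> finite (E `` {v}) \<and> card (E `` {v}) \<le> D"
    and "m * Suc D < card P"
  shows "\<exists>S\<subseteq>P. card S = Suc m \<and> (\<forall>v\<in>S. E `` {v} \<inter> S = {})"
  using assms(3-)
proof (induction m arbitrary: P)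
  case 0
  then obtain v where "v \<in> P" by fastforce
  with assms(2) show ?case by (intro exI[of _ "{v}"]) (auto simp: irrefl_def)
next
  case (Suc m)
  then obtain v where v: "v \<in> P" by fastforce
  let ?X = "insert v (E `` {v})"
  have X: "finite ?X" "card ?X \<le> Suc D" using Suc.prems(2)[OF v] by (auto simp: card_insert_if)
  have "card P - card ?X \<le> card (P - ?X)" by (rule diff_card_le_card_Diff) fact
  then have "m * Suc D < card (P - ?X)" using Suc.prems(3) X(2) by simp
  from Suc.IH[OF _ _ this] Suc.prems(1,2) obtain S
    where S: "S \<subseteq> P - ?X" "card S = Suc m" "\<forall>v\<in>S. E `` {v} \<inter> S = {}" by auto
  have "finite S" using S(2) card.infinite by fastforce
  moreover have "E `` {w} \<inter> insert v S = {}" if "w \<in> insert v S" for w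
    using that S(1,3) assms(2) symD[OF assms(1)] by (auto simp: irrefl_def)
  ultimately show ?case using S v by (intro exI[of _ "insert v S"]) (auto simp: card_insert_if)
qed

section \<open>Setting of the counting argument\<close>

text \<open>\<open>c\<close>, \<open>A\<close>, \<open>B\<close>, \<open>p\<close> describe the
  tree, \<open>no_embedding\<close> its absence, and \<open>l_bound\<close> what \<open>l\<close>
  inherits from \<open>S_graph n k\<close>. No vertex with \<open>y u = 1\<close> is fixed, as the
  argument is applied at several of them.\<close>

locale spectral_tree_free =
  fixes V :: "'a set" and E :: "'a rel" and n k :: nat
    and c :: 'b and A B :: "'b set" and p :: "'b \<Rightarrow> 'b"
    and y :: "'a \<Rightarrow> real" and l :: real
  assumes finite_V: "finite V" and card_V: "card V = n"
    and E_V: "E \<subseteq> V \<times> V" and sym_E: "sym E" and irrefl_E: "irrefl E"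
    and finite_A: "finite A" and finite_B: "finite B"
    and c_notin: "c \<notin> A" "c \<notin> B" and A_B: "A \<inter> B = {}" and p_B: "p ` B \<subseteq> A"
    and card_AB: "card A + card B = 2 * k + 1"
    and k: "k \<ge> 2" and n: "n > 2 * (k + 2) ^ 4"
    and no_embedding: "\<And>f. inj_on f (insert c (A \<union> B)) \<Longrightarrow> f ` insert c (A \<union> B) \<subseteq> V \<Longrightarrow>
           \<forall>a\<in>A. (f c, f a) \<in> E \<Longrightarrow> \<forall>b\<in>B. (f (p b), f b) \<in> E \<Longrightarrow> False"
    and y_nonneg: "\<And>v. 0 \<le> y v" and y_le_1: "\<And>v. y v \<le> 1"
    and l_nonneg: "0 \<le> l"
    and y_subinvariant: "\<And>v. v \<in> V \<Longrightarrow> l * y v \<le> (\<Sum>w\<in>E `` {v}. y w)"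
    and l_bound: "(real k - 1) * l + real k * (real n - real k) \<le> l\<^sup>2"
begin

abbreviation N :: "'a \<Rightarrow> 'a set" where "N v \<equiv> E `` {v}"

definition heavy :: "'a set" where "heavy = {v \<in> V. 2 * k + 1 \<le> card (N v)}"

section \<open>Neighbourhoods and extension of partial embeddings\<close>

lemma N_V: "N v \<subseteq> V"
  using E_V by auto

lemma finite_N: "finite (N v)"
  using N_V finite_V by (rule finite_subset)

lemma N_irrefl: "v \<notin> N v"
  using irrefl_E by (auto simp: irrefl_def)

lemma N_sym: "w \<in> N v \<longleftrightarrow> v \<in> N w"
  using sym_E by (auto dest: symD)

text \<open>\<open>g\<close> places neighbours of the centre including all parents, \<open>h\<close>
  places \<open>B\<close>. The rest of \<open>A\<close> are leaves, and they fit into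
  \<open>N u\<close>: it has at least \<open>card A + card B\<close> vertices, of which at most
  \<open>card A' + card B\<close> are taken.\<close>

lemma embedding_extend:
  assumes "u \<in> V" "A' \<subseteq> A" "p ` B \<subseteq> A'"
    and g: "inj_on g A'" "g ` A' \<subseteq> N u"
    and h: "inj_on h B" "\<And>b. b \<in> B \<Longrightarrow> h b \<in> N (g (p b)) - insert u (g ` A')"
    and "A' = A \<or> 2 * k + 1 \<le> card (N u)"
  shows False
proof -
  have finA': "finite A'" using finite_subset[OF assms(2) finite_A] .
  let ?X = "N u - g ` A' - h ` B"
  have "card (A - A') \<le> card ?X"
    using assms(8)
  proof
    assume "2 * k + 1 \<le> card (N u)"
    moreover have "card (g ` A') = card A'" "card (h ` B) = card B"
      using g(1) h(1) by (auto simp: card_image)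
    moreover have "card (A - A') = card A - card A'" using finA' assms(2) by (rule card_Diff_subset)
    moreover have "card (N u) - card (g ` A' \<union> h ` B) \<le> card (N u - (g ` A' \<union> h ` B))"
      by (rule diff_card_le_card_Diff) (simp add: finA' finite_B)
    moreover have "card (g ` A' \<union> h ` B) \<le> card (g ` A') + card (h ` B)" by (rule card_Un_le)
    moreover have "N u - (g ` A' \<union> h ` B) = ?X" by auto
    ultimately show ?thesis using card_AB by simp
  qed simp
  then obtain e where e: "e ` (A - A') \<subseteq> ?X" "inj_on e (A - A')"
    using card_le_inj[of "A - A'" ?X] finite_A finite_N by auto
  define f where "f x = (if x = c then u else if x \<in> A' then g x else if x \<in> A then e x else h x)" for x
  have fc: "f c = u" by (simp add: f_def)
  have fA': "f a = g a" if "a \<in> A'" for a using that assms(2) c_notin by (auto simp: f_def)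
  have fA: "f a = e a" if "a \<in> A - A'" for a using that c_notin by (auto simp: f_def)
  have fB: "f b = h b" if "b \<in> B" for b using that c_notin A_B assms(2) by (auto simp: f_def)
  have split: "insert c (A \<union> B) = insert c (A' \<union> (A - A') \<union> B)" using assms(2) by auto
  have gu: "g a \<noteq> u" if "a \<in> A'" for a using g(2) that N_irrefl by blast
  have eX: "e a \<noteq> u" "e a \<notin> g ` A'" "e a \<notin> h ` B" "e a \<in> N u" if "a \<in> A - A'" for a
    using e(1) that N_irrefl by blast+
  show False
  proof (rule no_embedding[of f])
    have inj_Un: "inj_on f (X \<union> Y)" if "inj_on f X" "inj_on f Y" "f ` X \<inter> f ` Y = {}" for X Y
      using that by (auto simp: inj_on_Un)
    have inj: "inj_on f A'" "inj_on f (A - A')" "inj_on f B"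
      using g(1) e(2) h(1) fA' fA fB by (auto simp: inj_on_def)
    have img: "f ` A' = g ` A'" "f ` (A - A') = e ` (A - A')" "f ` B = h ` B"
      using fA' fA fB by (auto simp: image_def)
    have "inj_on f (A' \<union> (A - A') \<union> B)"
    proof (intro inj_Un inj)
      show "f ` A' \<inter> f ` (A - A') = {}" unfolding img using e(1) by blast
      have "h ` B \<subseteq> - g ` A'" by (rule image_subsetI) (use h(2) in simp)
      then have "g ` A' \<inter> h ` B = {}" by blast
      moreover have "e ` (A - A') \<inter> h ` B = {}" using e(1) by blast
      ultimately show "f ` (A' \<union> (A - A')) \<inter> f ` B = {}" unfolding image_Un img by blast
    qed
    moreover have "f c \<notin> f ` (A' \<union> (A - A') \<union> B)"
      unfolding image_Un img fc using gu eX(1) h(2) by auto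
    ultimately show "inj_on f (insert c (A \<union> B))"
      unfolding split inj_on_insert by auto
    show "f ` insert c (A \<union> B) \<subseteq> V"
      using split fA' fA fB fc assms(1) h(2) g(2) eX(4) N_V by fastforce
    show "\<forall>a\<in>A. (f c, f a) \<in> E" using fc fA' fA g(2) eX(4) by force
    show "\<forall>b\<in>B. (f (p b), f b) \<in> E" using fA' fB h(2) assms(3) by force
  qed
qed

text \<open>Any bijection of \<open>A'\<close> onto \<open>S\<close> works, since \<open>B\<close>
  can then be placed greedily outside \<open>insert u S\<close>.\<close>

lemma embedding_extend_set:
  assumes "u \<in> V" "A' \<subseteq> A" "p ` B \<subseteq> A'" "S \<subseteq> N u" "card S = card A'"
    and "\<And>v. v \<in> S \<Longrightarrow> card B \<le> card (N v - insert u S)"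
    and "A' = A \<or> 2 * k + 1 \<le> card (N u)"
  shows False
proof -
  have fin: "finite A'" "finite S" using finite_subset[OF assms(2) finite_A] finite_subset[OF assms(4) finite_N] .
  with assms(5) obtain g where g: "bij_betw g A' S" 
    using finite_same_card_bij[OF fin] by auto
  then have gS: "g ` A' = S" by (simp add: bij_betw_def)
  have "card B \<le> card (N (g (p b)) - insert u S)" if "b \<in> B" for b
    using assms(3) that gS by (intro assms(6)) blast
  from ex_inj_choice[OF finite_B, of "\<lambda>b. N (g (p b)) - insert u S", OF this]
  obtain h where h: "inj_on h B" "\<forall>b\<in>B. h b \<in> N (g (p b)) - insert u S" by blast
  show False
    by (rule embedding_extend[of u A' g h]) (use assms g h gS in \<open>auto simp: bij_betw_def\<close>)
qed

lemma heavy_free_neighbours: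
  assumes "w \<in> heavy" "w \<in> S" "finite S"
  shows "2 * k + 1 - card S \<le> card (N w - insert u S)"
proof -
  \<comment> \<open>\<open>w\<close> is in \<open>S\<close> but not in \<open>N w\<close>, which
    compensates for removing \<open>u\<close>: at most \<open>card S\<close> neighbours are
    lost.\<close>
  have eq: "N w - insert u S = N w - insert u (S - {w})" using N_irrefl by auto
  have "card (insert u (S - {w})) \<le> Suc (card (S - {w}))" by (simp add: card_insert_if assms(3))
  also have "\<dots> = card S" using assms(2,3) using card_Suc_Diff1 by fastforce
  finally have "card (insert u (S - {w})) \<le> card S" .
  moreover have "card (N w) - card (insert u (S - {w})) \<le> card (N w - insert u (S - {w}))"
    by (rule diff_card_le_card_Diff) (use assms in auto)
  moreover have "2 * k + 1 \<le> card (N w)" using assms(1) by (simp add: heavy_def)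
  ultimately show ?thesis unfolding eq by linarith
qed

section \<open>Numerical bounds on \<open>n\<close>, \<open>l\<close> and \<open>y\<close>\<close>

lemma n_large: "25 * real k ^ 3 + real k \<le> real n" "5 * (real k)\<^sup>2 < real n"
proof -
  \<comment> \<open>The difference \<open>2 * (k + 2) ^ 4 - 25 * k ^ 3 - k\<close> equals this
    expression plus \<open>63 * k + 32\<close>.\<close>
  have "0 \<le> (real k)\<^sup>2 * (2 * (real k - 9 / 4)\<^sup>2 + 303 / 8)" by simp
  then have "25 * real k ^ 3 + real k \<le> 2 * (real k + 2) ^ 4" using k
    by (simp add: power2_eq_square power3_eq_cube power4_eq_xxxx algebra_simps)
  also have "real (2 * (k + 2) ^ 4) < real n" using n by (rule of_nat_less_iff[THEN iffD2])
  then have "2 * (real k + 2) ^ 4 < real n" by (simp add: add.commute)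
  finally show *: "25 * real k ^ 3 + real k \<le> real n" by simp
  have "(real k)\<^sup>2 * 5 \<le> (real k)\<^sup>2 * (25 * real k)" using k by (intro mult_left_mono) auto
  also have "\<dots> = 25 * real k ^ 3" by (simp add: power2_eq_square power3_eq_cube)
  finally show "5 * (real k)\<^sup>2 < real n" using * k by simp
qed

text \<open>As \<open>n - k\<close> is at least \<open>25 * k ^ 3\<close>, the term
  \<open>k * (n - k)\<close> of \<open>l_bound\<close> alone reaches the square of
  \<open>5 * k ^ 2\<close>.\<close>

lemma l_large: "5 * (real k)\<^sup>2 \<le> l"
proof -
  have "(5 * (real k)\<^sup>2)\<^sup>2 = real k * (25 * real k ^ 3)"
    by (simp add: power2_eq_square power3_eq_cube)
  also have "\<dots> \<le> real k * (real n - real k)" using n_large(1) by (intro mult_left_mono) auto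
  also have "\<dots> \<le> (real k - 1) * l + real k * (real n - real k)" using k l_nonneg by simp
  also have "\<dots> \<le> l\<^sup>2" by (rule l_bound)
  finally show ?thesis using l_nonneg by (rule power2_le_imp_le)
qed

lemma l_pos: "0 < l" and k_less_l: "2 * real k < l"
proof -
  have "2 * real k < 5 * (real k)\<^sup>2" using k by (simp add: power2_eq_square)
  with l_large show "2 * real k < l" by linarith
  then show "0 < l" using k by linarith
qed

lemma sum_y_le_card: "(\<Sum>w\<in>X. y w) \<le> real (card X)"
  using sum_bounded_above[of X y 1] y_le_1 by simp

lemma light_le: assumes "v \<in> V - heavy" shows "y v \<le> 2 * real k / l"
proof -
  have "l * y v \<le> real (card (N v))" using y_subinvariant[of v] sum_y_le_card[of "N v"] assms by simp
  also have "\<dots> \<le> 2 * real k" using assms by (auto simp: heavy_def)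
  finally show ?thesis using l_pos by (simp add: field_simps)
qed

text \<open>At most \<open>2 * k\<close> light neighbours weigh at most \<open>2 * k / l\<close>
  each, in total \<open>4 * k ^ 2 / l\<close>, which \<open>l_large\<close> keeps below 1.
  Essentially only heavy neighbours count.\<close>

lemma light_sum_le:
  assumes "v \<in> V - heavy"
  shows "l * y v \<le> real (card (N v \<inter> heavy)) + 4 / 5"
proof -
  have "l * y v \<le> (\<Sum>w\<in>N v. y w)" using y_subinvariant assms by blast
  also have "\<dots> = (\<Sum>w\<in>N v \<inter> heavy. y w) + (\<Sum>w\<in>N v - heavy. y w)"
    using finite_N by (rule sum.Int_Diff)
  also have "(\<Sum>w\<in>N v \<inter> heavy. y w) \<le> real (card (N v \<inter> heavy))" by (rule sum_y_le_card)
  also have "(\<Sum>w\<in>N v - heavy. y w) \<le> (\<Sum>w\<in>N v - heavy. 2 * real k / l)"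
    using light_le N_V by (intro sum_mono) blast
  also have "\<dots> = real (card (N v - heavy)) * (2 * real k / l)" by simp
  also have "\<dots> \<le> (2 * real k) * (2 * real k / l)"
  proof (rule mult_right_mono)
    have "card (N v - heavy) \<le> card (N v)" by (rule card_mono) (auto simp: finite_N)
    then show "real (card (N v - heavy)) \<le> 2 * real k" using assms by (auto simp: heavy_def)
  qed (use l_pos in simp)
  also have "\<dots> \<le> 4 / 5"
    using l_large l_pos by (simp add: power2_eq_square field_simps)
  finally show ?thesis by simp
qed

lemma maximizer_heavy:
  assumes "u \<in> V" "y u = 1" shows "u \<in> heavy"
  using y_subinvariant[OF assms(1)] assms sum_y_le_card[of "N u"] k_less_l by (simp add: heavy_def)

text \<open>Subinvariance at \<open>u\<close>, multiplied by \<open>l\<close>: heavy neighbours are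
  bounded by 1 each, light ones keep \<open>l * y v\<close> for a second application at
  \<open>v\<close>.\<close>

lemma l_square_le:
  assumes "u \<in> V" "y u = 1"
  shows "l\<^sup>2 \<le> real (card (N u \<inter> heavy)) * l + (\<Sum>v\<in>N u - heavy. l * y v)"
proof -
  have "l \<le> (\<Sum>w\<in>N u. y w)" using y_subinvariant[OF assms(1)] assms(2) by simp
  also have "\<dots> = (\<Sum>w\<in>N u \<inter> heavy. y w) + (\<Sum>w\<in>N u - heavy. y w)"
    using finite_N by (rule sum.Int_Diff)
  also have "(\<Sum>w\<in>N u \<inter> heavy. y w) \<le> real (card (N u \<inter> heavy))" by (rule sum_y_le_card)
  finally have "l * l \<le> l * (real (card (N u \<inter> heavy)) + (\<Sum>w\<in>N u - heavy. y w))"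
    using l_nonneg by (intro mult_left_mono) auto
  then show ?thesis by (simp add: power2_eq_square algebra_simps sum_distrib_left)
qed

lemma card_light_neighbours_le: assumes "u \<in> V" shows "card (N u - heavy) \<le> n - 1"
proof -
  have "N u - heavy \<subseteq> V - {u}" using N_V N_irrefl by blast
  then have "card (N u - heavy) \<le> card (V - {u})" using finite_V by (intro card_mono) auto
  then show ?thesis using assms card_V finite_V by simp
qed

section \<open>Excluding trees with \<open>card A\<close> at most \<open>k\<close>\<close>

lemma card_A_gt:
  assumes "u \<in> V" "y u = 1"
  shows "k < card A"
proof (rule ccontr)
  assume "\<not> ?thesis"
  then have A: "card A \<le> k" by simp
  have few: "card (N v \<inter> heavy) < card A" if "v \<in> V" for v
  proof (rule ccontr)
    assume "\<not> ?thesis"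
    then obtain S where S: "S \<subseteq> N v \<inter> heavy" "card S = card A" "finite S"
      using obtain_subset_with_card_n[of "card A" "N v \<inter> heavy"] by auto
    \<comment> \<open>Exactly enough: \<open>2 * k + 1 - card A = card B\<close>.\<close>
    have "card B \<le> card (N w - insert v S)" if "w \<in> S" for w
      using heavy_free_neighbours[of w S v] that S card_AB by auto
    then show False using embedding_extend_set[of v A S] that S p_B by auto
  qed
  \<comment> \<open>At most \<open>k - 1\<close> heavy neighbours, plus 4/5 for the light
    ones.\<close>
  have "l * y v \<le> real k - 1 / 5" if "v \<in> N u - heavy" for v
  proof -
    have "card (N v \<inter> heavy) + 1 \<le> k" using few[of v] that N_V A by fastforce
    then show ?thesis using light_sum_le[of v] that N_V by fastforce
  qed
  then have "(\<Sum>v\<in>N u - heavy. l * y v) \<le> real (card (N u - heavy)) * (real k - 1 / 5)"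
    by (rule sum_bounded_above)
  also have "\<dots> \<le> real n * (real k - 1 / 5)"
    using card_light_neighbours_le[OF assms(1)] k by (intro mult_right_mono) auto
  finally have "l\<^sup>2 \<le> real (card (N u \<inter> heavy)) * l + real n * (real k - 1 / 5)"
    using l_square_le[OF assms] by linarith
  also have "real (card (N u \<inter> heavy)) * l \<le> (real k - 1) * l"
    using few[OF assms(1)] A l_nonneg by (intro mult_right_mono) auto
  \<comment> \<open>The loss of 1/5 per vertex exceeds the \<open>k ^ 2\<close> by which
    \<open>k * (n - k)\<close> falls short of \<open>k * n\<close>.\<close>
  finally have "real n / 5 \<le> (real k)\<^sup>2" using l_bound by (simp add: algebra_simps power2_eq_square)
  then show False using n_large by simp
qed

section \<open>The neighbourhood of a maximizer \<open>u\<close>, where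
  \<open>card A > k\<close>\<close>

context
  fixes u
  assumes u: "u \<in> V" "y u = 1"
begin

lemma card_B_le: "card B \<le> k"
  using card_A_gt[OF u] card_AB by simp

lemma card_p_B_le: "card (p ` B) \<le> card B"
  using finite_B by (rule card_image_le)

lemma card_N_u: "2 * k + 1 \<le> card (N u)"
  using maximizer_heavy[OF u] by (simp add: heavy_def)

text \<open>Only the parents need places in \<open>S\<close>; the other neighbours of the centre are
  leaves and go anywhere in \<open>N u\<close>. Shrinking \<open>S\<close> only enlarges the free
  neighbourhoods.\<close>

lemma card_less_card_parents:
  assumes "S \<subseteq> N u" "\<And>v. v \<in> S \<Longrightarrow> card B \<le> card (N v - insert u S)"
  shows "card S < card (p ` B)"
proof (rule ccontr)
  assume "\<not> ?thesis"
  then obtain S' where S': "S' \<subseteq> S" "card S' = card (p ` B)"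
    using obtain_subset_with_card_n[of "card (p ` B)" S] by auto
  have "card B \<le> card (N v - insert u S')" if "v \<in> S'" for v
  proof -
    have "card (N v - insert u S) \<le> card (N v - insert u S')"
      using S'(1) finite_N by (intro card_mono) auto
    then show ?thesis using assms(2)[of v] that S'(1) by auto
  qed
  then show False
    using embedding_extend_set[of u "p ` B" S'] S' assms(1) u(1) p_B card_N_u by auto
qed

lemma card_heavy_neighbours_less: "card (N u \<inter> heavy) < card (p ` B)"
proof (rule ccontr)
  assume "\<not> ?thesis"
  then obtain S where S: "S \<subseteq> N u \<inter> heavy" "card S = card (p ` B)" "finite S"
    using obtain_subset_with_card_n[of "card (p ` B)" "N u \<inter> heavy"] by auto
  have "card B \<le> card (N v - insert u S)" if "v \<in> S" for v
    using heavy_free_neighbours[of v S u] that S card_B_le card_p_B_le by auto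
  then show False using card_less_card_parents[of S] S by auto
qed

text \<open>The set consists of light vertices, so heavy neighbours of its members lie outside it;
  discarding \<open>u\<close> leaves at least \<open>k\<close> of them, enough for
  \<open>B\<close>.\<close>

lemma card_many_heavy_neighbours:
  "card {v \<in> N u - heavy. k + 1 \<le> card (N v \<inter> heavy)} < card (p ` B)" (is "card ?S < _")
proof (rule card_less_card_parents)
  fix v assume v: "v \<in> ?S"
  have "card (N v \<inter> heavy - {u}) \<le> card (N v - insert u ?S)"
    using finite_N by (intro card_mono) auto
  moreover have "card (N v \<inter> heavy) - card {u} \<le> card (N v \<inter> heavy - {u})"
    by (rule diff_card_le_card_Diff) simp
  moreover have "k + 1 \<le> card (N v \<inter> heavy)" using v by simp
  ultimately show "card B \<le> card (N v - insert u ?S)" using card_B_le by simp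
qed auto

text \<open>Light degrees are at most \<open>2 * k\<close>, so a larger set would contain an
  independent set with one vertex per parent. Its members lose only \<open>u\<close> and keep
  \<open>k\<close> free neighbours.\<close>

lemma card_large_light_neighbours:
  "card {v \<in> N u - heavy. k + 1 \<le> card (N v)} \<le> (card (p ` B) - 1) * (2 * k + 1)" (is "card ?P \<le> _")
proof (rule ccontr)
  assume "\<not> ?thesis"
  then have lt: "(card (p ` B) - 1) * Suc (2 * k) < card ?P" by simp
  have light: "finite (N v) \<and> card (N v) \<le> 2 * k" if "v \<in> ?P" for v
    using that N_V finite_N by (fastforce simp: heavy_def)
  have "finite ?P" by (rule finite_subset[OF _ finite_N[of u]]) auto
  from ex_independent_subset[OF sym_E irrefl_E this light lt]
  obtain S where S: "S \<subseteq> ?P" "card S = Suc (card (p ` B) - 1)" "\<forall>v\<in>S. N v \<inter> S = {}"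
    by blast
  have "card B \<le> card (N v - insert u S)" if "v \<in> S" for v
  proof -
    have "N v - insert u S = N v - {u}" using S(3) that by auto
    moreover have "card (N v) - card {u} \<le> card (N v - {u})"
      by (rule diff_card_le_card_Diff) simp
    ultimately show ?thesis using S(1) that card_B_le by auto
  qed
  moreover have "S \<subseteq> N u" using S(1) by auto
  ultimately show False using card_less_card_parents[of S] S(2) by auto
qed

lemma card_heavy_neighbours: "card (N u \<inter> heavy) = k - 1"
proof (rule ccontr)
  assume neq: "\<not> ?thesis"
  have parents: "card (p ` B) \<le> k" using card_p_B_le card_B_le by simp
  with neq card_heavy_neighbours_less have h: "card (N u \<inter> heavy) + 2 \<le> k" by linarith
  \<comment> \<open>A light neighbour contributes at most \<open>k\<close> outside \<open>?P\<close>, at most \<open>k + 1\<close> in \<open>?P\<close> and at most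
    \<open>2 k\<close> in \<open>?P1\<close>. The total excess over \<open>k\<close> is smaller than \<open>l\<close>, so it cannot make up for a
    missing heavy neighbour.\<close>
  let ?P1 = "{v \<in> N u - heavy. k + 1 \<le> card (N v \<inter> heavy)}"
  let ?P = "{v \<in> N u - heavy. k + 1 \<le> card (N v)}"
  have fin: "finite (N u - heavy)" using finite_N by simp
  have "l * y v \<le> real k + (if v \<in> ?P1 then real k else 0) + (if v \<in> ?P then 1 else 0)"
    if v: "v \<in> N u - heavy" for v
  proof -
    have vV: "v \<in> V - heavy" using v N_V by auto
    have le: "l * y v \<le> real (card (N v))"
      using y_subinvariant[of v] vV sum_y_le_card[of "N v"] by simp
    consider "v \<in> ?P1" | "v \<notin> ?P1" "v \<in> ?P" | "v \<notin> ?P" by blast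
    then show ?thesis
    proof cases
      case 1
      have "card (N v) \<le> 2 * k" using vV by (auto simp: heavy_def)
      with le 1 show ?thesis by simp
    next
      \<comment> \<open>At most \<open>k\<close> heavy neighbours, and the 4/5 for the light ones is
        rounded up to 1.\<close>
      case 2
      then show ?thesis using light_sum_le[OF vV] v by auto
    next
      case 3
      then show ?thesis using le v by auto
    qed
  qed
  then have "(\<Sum>v\<in>N u - heavy. l * y v) \<le>
      (\<Sum>v\<in>N u - heavy. real k + (if v \<in> ?P1 then real k else 0) + (if v \<in> ?P then 1 else 0))"
    by (rule sum_mono)
  also have "\<dots> = real (card (N u - heavy)) * real k + real (card ?P1) * real k + real (card ?P)"
  proof -
    have "(\<Sum>v\<in>N u - heavy. if v \<in> ?P1 then real k else 0) = (\<Sum>v\<in>?P1. real k)"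
      using fin by (intro sum.mono_neutral_cong_right) auto
    moreover have "(\<Sum>v\<in>N u - heavy. if v \<in> ?P then 1 else 0) = (\<Sum>v\<in>?P. 1::real)"
      using fin by (intro sum.mono_neutral_cong_right) auto
    ultimately show ?thesis by (simp only: sum.distrib) simp
  qed
  also have "\<dots> \<le> (real n - 1) * real k + (real k - 1) * real k + (real k - 1) * (2 * real k + 1)"
  proof (intro add_mono mult_right_mono)
    show "real (card (N u - heavy)) \<le> real n - 1"
      using card_light_neighbours_le[OF u(1)] n by (simp add: of_nat_diff[symmetric])
    show "real (card ?P1) \<le> real k - 1" using card_many_heavy_neighbours parents by linarith
    have "card ?P \<le> (k - 1) * (2 * k + 1)"
      using card_large_light_neighbours parents by (meson diff_le_mono le_trans mult_le_mono1)
    then have "real (card ?P) \<le> real ((k - 1) * (2 * k + 1))" by (rule of_nat_mono)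
    also have "\<dots> = real (k - 1) * (2 * real k + 1)" unfolding of_nat_mult by simp
    also have "real (k - 1) = real k - 1" using k by (simp add: of_nat_diff)
    finally show "real (card ?P) \<le> (real k - 1) * (2 * real k + 1)" .
  qed auto
  finally have "l\<^sup>2 \<le> real (card (N u \<inter> heavy)) * l +
      ((real n - 1) * real k + (real k - 1) * real k + (real k - 1) * (2 * real k + 1))"
    using l_square_le[OF u] by linarith
  also have "real (card (N u \<inter> heavy)) * l \<le> (real k - 2) * l"
    using h l_nonneg by (intro mult_right_mono) auto
  \<comment> \<open>Against \<open>l_bound\<close> the terms \<open>k * n\<close> cancel, and the
    coefficients \<open>k - 1\<close> and \<open>k - 2\<close> of \<open>l\<close> leave one
    \<open>l\<close>.\<close>
  finally have "l \<le> 4 * (real k)\<^sup>2 - 3 * real k - 1"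
    using l_bound by (simp add: algebra_simps power2_eq_square)
  moreover have "0 \<le> (real k)\<^sup>2" by simp
  ultimately show False using l_large k by linarith
qed

section \<open>The extremal case\<close>

text \<open>The number of parents exceeds \<open>k - 1\<close> and is at most \<open>card B\<close>,
  itself at most \<open>k\<close>. So each parent has exactly one child.\<close>

lemma inj_on_p: "inj_on p B" and card_B: "card B = k"
proof -
  have "k \<le> card (p ` B)" using card_heavy_neighbours card_heavy_neighbours_less by simp
  then have "card (p ` B) = card B" "card B = k" using card_p_B_le card_B_le by auto
  then show "inj_on p B" "card B = k" using finite_B by (auto simp: eq_card_imp_inj_on)
qed

text \<open>Otherwise \<open>v\<close> and the \<open>k - 1\<close> heavy neighbours of
  \<open>u\<close> could serve as the \<open>k\<close> parents: \<open>v\<close> needs just the one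
  child \<open>z\<close>, and the heavy parents have room for theirs.\<close>

lemma light_neighbours_subset:
  assumes v: "v \<in> N u - heavy"
  shows "N v \<subseteq> insert u (N u \<inter> heavy)"
proof
  fix z assume z: "z \<in> N v"
  show "z \<in> insert u (N u \<inter> heavy)"
  proof (rule ccontr)
    assume z': "\<not> ?thesis"
    let ?S = "insert v (N u \<inter> heavy)"
    have S: "finite ?S" "card ?S = k"
      using v finite_N card_heavy_neighbours k by auto
    have "card (p ` B) = card ?S" using inj_on_p card_B S(2) by (simp add: card_image)
    then obtain g where g: "bij_betw g (p ` B) ?S"
      using finite_same_card_bij[of "p ` B" ?S] finite_B S(1) by auto
    then have gS: "g ` p ` B = ?S" by (simp add: bij_betw_def)
    then obtain b0 where b0: "b0 \<in> B" "g (p b0) = v" by force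
    have "card B \<le> card (N (g (p b)) - insert u ?S)" if b: "b \<in> B - {b0}" for b
    proof -
      have "p b \<noteq> p b0" using inj_on_p b b0(1) by (auto simp: inj_on_def)
      then have "g (p b) \<noteq> v" using g b b0 by (auto simp: bij_betw_def inj_on_def)
      then have "g (p b) \<in> heavy" "g (p b) \<in> ?S" using gS b by blast+
      from heavy_free_neighbours[OF this S(1), of u] show ?thesis using S(2) card_B by simp
    qed
    moreover have "z \<in> N (g (p b0)) - insert u ?S" using z z' b0 N_irrefl by auto
    ultimately obtain h where h: "inj_on h B" "\<forall>b\<in>B. h b \<in> N (g (p b)) - insert u ?S"
      using ex_inj_choice_but_one[OF finite_B b0(1), of "\<lambda>b. N (g (p b)) - insert u ?S"] by blast
    show False
    proof (rule embedding_extend[of u "p ` B" g h])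
      show "g ` p ` B \<subseteq> N u" unfolding gS using v by auto
      show "h b \<in> N (g (p b)) - insert u (g ` p ` B)" if "b \<in> B" for b
        unfolding gS using h(2) that by blast
    qed (use u p_B g h card_N_u in \<open>auto simp: bij_betw_def\<close>)
  qed
qed

lemma card_core: "card (insert u (N u \<inter> heavy)) = k"
  using card_heavy_neighbours finite_N N_irrefl[of u] k by simp

text \<open>At most \<open>n - k\<close> light neighbours of \<open>u\<close> contribute at most
  \<open>card W = k\<close> each, while \<open>l_bound\<close> demands \<open>k * (n - k)\<close>;
  hence all these estimates are tight.\<close>

lemma core_structure:
  assumes "W = insert u (N u \<inter> heavy)"
  shows "N u - heavy = V - W" "\<And>v. v \<in> V - W \<Longrightarrow> N v = W" "\<And>w. w \<in> W \<Longrightarrow> y w = 1"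
proof -
  have W: "card W = k" "W \<subseteq> V" "finite W" using card_core assms N_V u(1) finite_N by auto
  have sub: "N u - heavy \<subseteq> V - W" using assms N_V N_irrefl by auto
  have card_VW: "card (V - W) = n - k" using W card_V by (simp add: card_Diff_subset)
  have n_k: "k \<le> n" using W card_V finite_V card_mono by metis
  have Nv: "N v \<subseteq> W" if "v \<in> N u - heavy" for v using light_neighbours_subset[OF that] assms by simp
  have le_k: "(\<Sum>w\<in>N v. y w) \<le> real k" if "v \<in> N u - heavy" for v
    using sum_y_le_card[of "N v"] card_mono[OF W(3) Nv[OF that]] W(1) by simp
  have "l\<^sup>2 \<le> (real k - 1) * l + (\<Sum>v\<in>N u - heavy. l * y v)"
    using l_square_le[OF u] card_heavy_neighbours k by simp
  also have "(\<Sum>v\<in>N u - heavy. l * y v) \<le> (\<Sum>v\<in>N u - heavy. \<Sum>w\<in>N v. y w)"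
    using y_subinvariant N_V by (intro sum_mono) blast
  finally have ge: "real k * (real n - real k) \<le> (\<Sum>v\<in>N u - heavy. \<Sum>w\<in>N v. y w)"
    using l_bound by simp
  also have "\<dots> \<le> real (card (N u - heavy)) * real k" using le_k by (rule sum_bounded_above)
  finally have "real (n - k) \<le> real (card (N u - heavy))" using n_k k by (simp add: of_nat_diff mult.commute)
  then have "card (V - W) \<le> card (N u - heavy)" using card_VW by simp
  then show eq: "N u - heavy = V - W"
    using sub finite_V by (intro card_seteq) auto
  have tight: "(\<Sum>w\<in>N v. y w) = real k" if "v \<in> V - W" for v
  proof -
    have "(\<Sum>v\<in>V - W. real k - (\<Sum>w\<in>N v. y w)) \<le> 0"
      using ge eq card_VW n_k by (simp add: sum_subtractf of_nat_diff mult.commute)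
    moreover have "0 \<le> real k - (\<Sum>w\<in>N v. y w)" if "v \<in> V - W" for v
      using le_k eq that by simp
    ultimately have "\<forall>v\<in>V - W. real k - (\<Sum>w\<in>N v. y w) = 0"
      using finite_V by (metis (no_types, lifting) sum_nonneg_eq_0_iff finite_Diff order_antisym sum_nonneg)
    then show ?thesis using that by simp
  qed
  have n_gt: "k < n" 
  proof -
    have "0 < real k ^ 3" using k by simp
    then have "real k < real n" using n_large(1) by linarith
    then show ?thesis by simp
  qed
  then obtain v0 where v0: "v0 \<in> V - W" using card_VW by (metis card.empty diff_is_0_eq equals0I not_le)
  show y1: "y w = 1" if w: "w \<in> W" for w
  proof -
    \<comment> \<open>\<open>N v0\<close> lies in \<open>W\<close> and already weighs
      \<open>k = card W\<close>, so no vertex of \<open>W\<close> can weigh less than 1.\<close>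
    have "real k \<le> (\<Sum>w\<in>W. y w)"
      using tight[OF v0] sum_mono2[OF W(3) Nv[of v0], of y] eq v0 y_nonneg by simp
    then have "(\<Sum>w\<in>W. 1 - y w) \<le> 0" using W(1) by (simp add: sum_subtractf)
    moreover have "1 - y w \<le> (\<Sum>w\<in>W. 1 - y w)"
      using W(3) w y_le_1 by (intro member_le_sum) auto
    ultimately show ?thesis using y_le_1[of w] by linarith
  qed
  show "N v = W" if "v \<in> V - W" for v
  proof (rule card_subset_eq[OF W(3)])
    show "N v \<subseteq> W" using Nv eq that by simp
    \<comment> \<open>With weight 1 on \<open>W\<close>, the tight sum counts the neighbours of
      \<open>v\<close>.\<close>
    then have "(\<Sum>w\<in>N v. y w) = real (card (N v))" using y1 by (simp add: subset_iff)
    then show "card (N v) = card W" using tight[OF that] W(1) by simp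
  qed
qed

end

text \<open>Every \<open>w\<close> in \<open>W\<close> is again a maximizer. Its core has
  \<open>k\<close> vertices and lies in \<open>W\<close>, as all heavy vertices do, so it equals
  \<open>W\<close>; thus \<open>W\<close> is a clique.\<close>

lemma graph_structure:
  assumes "u \<in> V" "y u = 1"
  obtains W where "W \<subseteq> V" "card W = k" "\<And>v. v \<in> V - W \<Longrightarrow> N v = W" "\<And>w. w \<in> W \<Longrightarrow> N w = V - {w}"
proof -
  define W where "W = insert u (N u \<inter> heavy)"
  note s = core_structure[OF assms W_def]
  have W: "W \<subseteq> V" "card W = k" "finite W"
    using card_core[OF assms] N_V assms(1) finite_N by (auto simp: W_def)
  have hW: "heavy \<subseteq> W" using s(1) by (auto simp: heavy_def)
  have "N w = V - {w}" if w: "w \<in> W" for w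
  proof -
    have wV: "w \<in> V" "y w = 1" using w W(1) s(3) by auto
    have "insert w (N w \<inter> heavy) = W"
      using W hW w card_core[OF wV] by (intro card_subset_eq) auto
    moreover have "V - W \<subseteq> N w" using s(2) w N_sym by blast
    ultimately show ?thesis using N_V[of w] N_irrefl[of w] by auto
  qed
  with that[OF W(1,2)] s(2) show thesis by blast
qed

end

section \<open>Eigenvalues of adjacency matrices\<close>

lemma digraph_isoI:
  fixes G :: "'a pair_pre_digraph" and H :: "'b pair_pre_digraph"
  assumes "pair_wf_digraph G" "inj_on f (pverts G)" "pverts H = f ` pverts G"
    and "parcs H = map_prod f f ` parcs G"
  shows "digraph_iso G H"
proof -
  interpret pair_wf_digraph G by fact
  let ?h = "\<lparr>iso_verts = f, iso_arcs = map_prod f f, iso_head = snd, iso_tail = fst\<rparr>"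
  have "inj_on (map_prod f f) (parcs G)"
    by (rule inj_on_subset[OF map_prod_inj_on[OF assms(2,2)]]) (use wellformed' in auto)
  then have "digraph_isomorphism ?h"
    using assms(2) wf_digraph_axioms by (auto simp: digraph_isomorphism_def)
  moreover have "with_proj H = app_iso ?h (with_proj G)"
    using assms(3,4) by (simp add: with_proj_def app_iso_def)
  ultimately show ?thesis unfolding digraph_iso_def by blast
qed

lemma contains_subgraphI:
  fixes G :: "'a pair_pre_digraph" and T :: "'b pair_pre_digraph"
  assumes "pair_wf_digraph G" "pair_wf_digraph T" "inj_on f (pverts T)" "f ` pverts T \<subseteq> pverts G"
    and "\<And>x y. (x, y) \<in> parcs T \<Longrightarrow> (f x, f y) \<in> parcs G"
  shows "contains_subgraph G T"
proof -
  define H where "H = \<lparr>pverts = f ` pverts T, parcs = map_prod f f ` parcs T\<rparr>"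
  interpret G: pair_wf_digraph G by fact
  interpret T: pair_wf_digraph T by fact
  interpret H: pair_wf_digraph H
    by unfold_locales (auto simp: H_def dest: T.wellformed')
  have "subgraph H G"
    using assms(4,5) G.wf_digraph_axioms H.wf_digraph_axioms
    by (auto simp: subgraph_def compatible_def H_def)
  moreover have "digraph_iso T H"
    using assms(2,3) by (rule digraph_isoI) (simp_all add: H_def)
  ultimately show ?thesis unfolding contains_subgraph_def by blast
qed

section \<open>Real spectrum, and eigenvectors as functions on vertices\<close>

text \<open>This makes the \<open>Max\<close> in \<open>largest_eigenvalue\<close> meaningful. Some
  complex eigenvalue exists, symmetry makes it real, and it is then a root of the real
  characteristic polynomial.\<close>

lemma real_symmetric_spectrum_nonempty:
  fixes M :: "real mat"
  assumes M: "M \<in> carrier_mat n n" and "0 < n"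
    and sym: "\<And>i j. i < n \<Longrightarrow> j < n \<Longrightarrow> M $$ (i, j) = M $$ (j, i)"
  shows "spectrum M \<noteq> {}"
proof -
  let ?C = "map_mat complex_of_real M"
  have C: "?C \<in> carrier_mat n n" using M by simp
  obtain e where e: "e \<in> spectrum ?C" using spectrum_non_empty[OF C \<open>0 < n\<close>] by blast
  then obtain v where "eigenvector ?C v e" by (auto simp: spectrum_def eigenvalue_def)
  then have v: "v \<in> carrier_vec n" "v \<noteq> 0\<^sub>v n" "?C *\<^sub>v v = e \<cdot>\<^sub>v v"
    using M by (auto simp: eigenvector_def)
  have Cv: "(\<Sum>j<n. complex_of_real (M $$ (i, j)) * v $ j) = e * v $ i" if "i < n" for i
  proof -
    have "(?C *\<^sub>v v) $ i = (\<Sum>j<n. complex_of_real (M $$ (i, j)) * v $ j)"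
      using that M v(1) by (simp add: scalar_prod_def atLeast0LessThan)
    then show ?thesis using v(1,3) that by simp
  qed
  \<comment> \<open>\<open>Q\<close> is the Hermitian form of the matrix at \<open>v\<close> and
    \<open>R\<close> the squared norm; \<open>Q\<close> is its own conjugate by symmetry, so
    \<open>Q = e * R\<close> makes \<open>e\<close> real.\<close>
  define Q where "Q = (\<Sum>i<n. \<Sum>j<n. complex_of_real (M $$ (i, j)) * (cnj (v $ i) * v $ j))"
  define R where "R = (\<Sum>i<n. (cmod (v $ i))\<^sup>2)"
  have "Q = (\<Sum>i<n. cnj (v $ i) * (\<Sum>j<n. complex_of_real (M $$ (i, j)) * v $ j))"
    unfolding Q_def by (simp add: sum_distrib_left mult_ac)
  also have "\<dots> = (\<Sum>i<n. e * (v $ i * cnj (v $ i)))"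
    using Cv by (intro sum.cong) (auto simp: mult_ac)
  also have "\<dots> = e * complex_of_real R"
    unfolding R_def of_real_sum by (simp only: complex_norm_square sum_distrib_left)
  finally have Q: "Q = e * complex_of_real R" .
  have "cnj Q = (\<Sum>i<n. \<Sum>j<n. complex_of_real (M $$ (j, i)) * (cnj (v $ j) * v $ i))"
    unfolding Q_def using sym by (simp add: mult_ac)
  also have "\<dots> = Q" unfolding Q_def by (rule sum.swap)
  finally have "cnj e * complex_of_real R = e * complex_of_real R" using Q by simp
  moreover have "R \<noteq> 0"
  proof
    assume "R = 0"
    then have "\<forall>i\<in>{..<n}. (cmod (v $ i))\<^sup>2 = 0" unfolding R_def by (subst (asm) sum_nonneg_eq_0_iff) auto
    then have "v = 0\<^sub>v n" using v(1) by (intro eq_vecI) auto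
    with v(2) show False by simp
  qed
  ultimately have "cnj e = e" by simp
  then obtain r where r: "e = complex_of_real r" by (metis Reals_cases Reals_cnj_iff)
  have "char_poly ?C = map_poly complex_of_real (char_poly M)"
    using of_real_hom.char_poly_hom[OF M] .
  moreover have "poly (char_poly ?C) e = 0" using e spectrum_root_char_poly[OF C] by simp
  ultimately have "poly (char_poly M) r = 0" unfolding r by simp
  then show ?thesis using spectrum_root_char_poly[OF M] by auto
qed

lemma vertex_enum:
  assumes "finite (pverts G)"
  shows "distinct (vertex_enum G)" "set (vertex_enum G) = pverts G"
proof -
  have "\<exists>vs. distinct vs \<and> set vs = pverts G" using finite_distinct_list[OF assms] by blast
  from someI_ex[OF this] show "distinct (vertex_enum G)" "set (vertex_enum G) = pverts G"
    by (simp_all add: vertex_enum_def)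
qed

lemma adjacency_matrix_carrier:
  "adjacency_matrix G \<in> carrier_mat (card (pverts G)) (card (pverts G))"
  by (simp add: adjacency_matrix_def)

text \<open>Vectors are pulled back along the enumeration of the vertices, which removes the
  arbitrary choice from all later arguments.\<close>

lemma eigenvalue_adjacency_matrix_iff:
  assumes fin: "finite (pverts G)" and arcs: "parcs G \<subseteq> pverts G \<times> pverts G"
  shows "eigenvalue (adjacency_matrix G) l \<longleftrightarrow>
    (\<exists>x. (\<exists>v\<in>pverts G. x v \<noteq> 0) \<and> (\<forall>v\<in>pverts G. (\<Sum>w\<in>parcs G `` {v}. x w) = l * x v))"
proof -
  let ?n = "card (pverts G)" and ?A = "adjacency_matrix G" and ?e = "\<lambda>i. vertex_enum G ! i"
  have len: "length (vertex_enum G) = ?n" using vertex_enum[OF fin] distinct_card by metis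
  have bij: "bij_betw ?e {..<?n} (pverts G)"
    by (rule bij_betw_nth[OF vertex_enum(1)[OF fin]]) (simp_all add: len vertex_enum(2)[OF fin])
  then have img: "?e ` {..<?n} = pverts G" by (simp add: bij_betw_def)
  have mult: "(?A *\<^sub>v vec ?n (\<lambda>i. x (?e i))) $ i = (\<Sum>w\<in>parcs G `` {?e i}. x w)" if i: "i < ?n" for x i
  proof -
    have "(?A *\<^sub>v vec ?n (\<lambda>i. x (?e i))) $ i = (\<Sum>j<?n. if (?e i, ?e j) \<in> parcs G then x (?e j) else 0)"
      using i by (auto simp: adjacency_matrix_def scalar_prod_def atLeast0LessThan intro!: sum.cong)
    also have "\<dots> = (\<Sum>w\<in>pverts G. if (?e i, w) \<in> parcs G then x w else 0)"
      by (rule sum.reindex_bij_betw[OF bij])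
    also have "\<dots> = (\<Sum>w\<in>parcs G `` {?e i}. x w)"
      using fin arcs by (intro sum.mono_neutral_cong_right) auto
    finally show ?thesis .
  qed
  have dim: "dim_row ?A = ?n" by (simp add: adjacency_matrix_def)
  have vec_iff: "eigenvector ?A (vec ?n (\<lambda>i. x (?e i))) l \<longleftrightarrow>
      (\<exists>v\<in>pverts G. x v \<noteq> 0) \<and> (\<forall>v\<in>pverts G. (\<Sum>w\<in>parcs G `` {v}. x w) = l * x v)" for x
  proof -
    have "vec ?n (\<lambda>i. x (?e i)) \<noteq> 0\<^sub>v ?n \<longleftrightarrow> (\<exists>i<?n. x (?e i) \<noteq> 0)"
      by (auto simp: vec_eq_iff)
    also have "\<dots> \<longleftrightarrow> (\<exists>v\<in>?e ` {..<?n}. x v \<noteq> 0)" by blast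
    finally have nz: "vec ?n (\<lambda>i. x (?e i)) \<noteq> 0\<^sub>v ?n \<longleftrightarrow> (\<exists>v\<in>pverts G. x v \<noteq> 0)"
      unfolding img .
    have "?A *\<^sub>v vec ?n (\<lambda>i. x (?e i)) = l \<cdot>\<^sub>v vec ?n (\<lambda>i. x (?e i)) \<longleftrightarrow>
        (\<forall>i<?n. (\<Sum>w\<in>parcs G `` {?e i}. x w) = l * x (?e i))"
      using mult dim by (auto simp: vec_eq_iff)
    also have "\<dots> \<longleftrightarrow> (\<forall>v\<in>?e ` {..<?n}. (\<Sum>w\<in>parcs G `` {v}. x w) = l * x v)" by blast
    finally show ?thesis using nz unfolding img by (simp add: eigenvector_def dim)
  qed
  have "\<exists>x. v = vec ?n (\<lambda>i. x (?e i))" if v: "v \<in> carrier_vec ?n" for v :: "real vec"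
  proof (intro exI eq_vecI)
    let ?x = "\<lambda>w. v $ the_inv_into {..<?n} ?e w"
    show "v $ i = vec ?n (\<lambda>i. ?x (?e i)) $ i" if "i < dim_vec (vec ?n (\<lambda>i. ?x (?e i)))" for i
      using that bij by (simp add: bij_betw_def the_inv_into_f_f)
  qed (use v in simp)
  then have "eigenvalue ?A l \<longleftrightarrow> (\<exists>x. eigenvector ?A (vec ?n (\<lambda>i. x (?e i))) l)"
    unfolding eigenvalue_def by (metis eigenvector_def dim)
  then show ?thesis using vec_iff by simp
qed

lemma finite_spectrum_adjacency_matrix: "finite (spectrum (adjacency_matrix G))"
  using card_finite_spectrum(1)[OF adjacency_matrix_carrier] .

section \<open>Spectral bounds for \<open>S_graph\<close> and for \<open>G\<close>\<close>

lemma S_graph_simps: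
  "pverts (S_graph n k) = {..<k} <+> {..<n - k}"
  "parcs (S_graph n k) = {(Inl u, Inl v) | u v. u < k \<and> v < k \<and> u \<noteq> v}
     \<union> {(Inl u, Inr v) | u v. u < k \<and> v < n - k} \<union> {(Inr v, Inl u) | u v. u < k \<and> v < n - k}"
  by (auto simp: S_graph_def graph_join_def complete_graph_def edgeless_graph_def)

lemma S_graph_eigenvalue:
  assumes "0 < k" "k \<le> n"
    and l: "0 < l" "l\<^sup>2 = (real k - 1) * l + real k * (real n - real k)"
  shows "l \<le> largest_eigenvalue (S_graph n k)"
proof -
  let ?S = "S_graph n k"
  \<comment> \<open>On the clique the eigenvalue equation is the quadratic for \<open>l\<close>; on
    the independent part it reads \<open>k * l = l * k\<close>.\<close>
  define x where "x w = (case w of Inl _ \<Rightarrow> l | Inr _ \<Rightarrow> real k)" for w :: "nat + nat"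
  have "(\<Sum>w\<in>parcs ?S `` {v}. x w) = l * x v" if v: "v \<in> pverts ?S" for v
  proof (cases v)
    case (Inl i)
    then have i: "i < k" using v by (auto simp: S_graph_simps)
    have "parcs ?S `` {v} = ({..<k} - {i}) <+> {..<n - k}"
      using Inl i by (auto simp: S_graph_simps)
    then have "(\<Sum>w\<in>parcs ?S `` {v}. x w) = (real k - 1) * l + real (n - k) * real k"
      using i by (simp add: sum.Plus x_def of_nat_diff)
    then show ?thesis using l(2) Inl assms(2) by (simp add: x_def power2_eq_square of_nat_diff mult.commute)
  next
    case (Inr i)
    then have "parcs ?S `` {v} = {..<k} <+> {}" using v by (auto simp: S_graph_simps)
    then show ?thesis using Inr by (simp add: sum.Plus x_def)
  qed
  moreover have "x (Inl 0) \<noteq> 0" "Inl 0 \<in> pverts ?S" using l(1) assms(1) by (auto simp: x_def S_graph_simps)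
  ultimately have "eigenvalue (adjacency_matrix ?S) l"
    by (subst eigenvalue_adjacency_matrix_iff) (auto simp: S_graph_simps)
  then show ?thesis
    unfolding largest_eigenvalue_def
    by (intro Max_ge finite_spectrum_adjacency_matrix) (simp add: spectrum_def)
qed

text \<open>Absolute values in the eigenvector equation and the triangle inequality give the bound;
  dividing by the maximum makes it 1 at \<open>u\<close>.\<close>

lemma largest_eigenvalue_subinvariant:
  fixes G :: "'a pair_pre_digraph"
  assumes "pair_graph G" "pverts G \<noteq> {}" "0 \<le> largest_eigenvalue G"
  obtains y u where "\<And>v. 0 \<le> y v" "\<And>v. y v \<le> 1" "u \<in> pverts G" "y u = 1"
    "\<And>v. v \<in> pverts G \<Longrightarrow> largest_eigenvalue G * y v \<le> (\<Sum>w\<in>parcs G `` {v}. y w)"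
proof -
  interpret pair_graph G by fact
  let ?l = "largest_eigenvalue G"
  have arcs: "parcs G \<subseteq> pverts G \<times> pverts G" using wellformed' by auto
  have len: "length (vertex_enum G) = card (pverts G)"
    using vertex_enum[OF pair_finite_verts] distinct_card by metis
  have "sym (parcs G)" using pair_sym_arcs unfolding symmetric_def by simp
  then have "spectrum (adjacency_matrix G) \<noteq> {}"
    by (intro real_symmetric_spectrum_nonempty[OF adjacency_matrix_carrier])
      (auto simp: adjacency_matrix_def card_gt_0_iff assms(2) pair_finite_verts dest: symD)
  then have "?l \<in> spectrum (adjacency_matrix G)"
    unfolding largest_eigenvalue_def by (rule Max_in[OF finite_spectrum_adjacency_matrix])
  then obtain x v0 where x: "v0 \<in> pverts G" "x v0 \<noteq> 0"
      "\<And>v. v \<in> pverts G \<Longrightarrow> (\<Sum>w\<in>parcs G `` {v}. x w) = ?l * x v"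
    using eigenvalue_adjacency_matrix_iff[OF pair_finite_verts arcs] by (auto simp: spectrum_def)
  define m where "m = Max ((\<lambda>v. \<bar>x v\<bar>) ` pverts G)"
  have le_m: "\<bar>x v\<bar> \<le> m" if "v \<in> pverts G" for v
    unfolding m_def using that pair_finite_verts by (intro Max_ge) auto
  have "m \<in> (\<lambda>v. \<bar>x v\<bar>) ` pverts G"
    unfolding m_def using pair_finite_verts assms(2) by (intro Max_in) auto
  then obtain u where u: "u \<in> pverts G" "m = \<bar>x u\<bar>" by blast
  have m: "0 < m" using le_m[OF x(1)] x(2) by linarith
  \<comment> \<open>The default 0 makes the bounds on \<open>y\<close> hold for every
    \<open>v\<close>.\<close>
  define y where "y v = (if v \<in> pverts G then \<bar>x v\<bar> / m else 0)" for v
  show thesis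
  proof (rule that[of y u])
    show "0 \<le> y v" "y v \<le> 1" for v using m le_m by (auto simp: y_def)
    show "u \<in> pverts G" "y u = 1" using u m by (auto simp: y_def)
    show "?l * y v \<le> (\<Sum>w\<in>parcs G `` {v}. y w)" if v: "v \<in> pverts G" for v
    proof -
      have "?l * \<bar>x v\<bar> = \<bar>\<Sum>w\<in>parcs G `` {v}. x w\<bar>" using x(3)[OF v] assms(3) by (simp add: abs_mult)
      also have "\<dots> \<le> (\<Sum>w\<in>parcs G `` {v}. \<bar>x w\<bar>)" by (rule sum_abs)
      finally have "?l * \<bar>x v\<bar> / m \<le> (\<Sum>w\<in>parcs G `` {v}. \<bar>x w\<bar>) / m"
        using m by (intro divide_right_mono) auto
      also have "\<dots> = (\<Sum>w\<in>parcs G `` {v}. y w)"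
        unfolding sum_divide_distrib using arcs by (intro sum.cong) (auto simp: y_def)
      finally show ?thesis using v by (simp add: y_def)
    qed
  qed
qed

section \<open>Recognizing \<open>S_graph\<close>\<close>

text \<open>In both graphs distinct vertices are adjacent iff one of them lies in the core, so any
  bijections between the cores and between the remaining vertices combine to an isomorphism.\<close>

lemma join_structure_iso_S_graph:
  fixes G :: "'a pair_pre_digraph"
  assumes "pair_graph G" "card (pverts G) = n" "W \<subseteq> pverts G" "card W = k"
    and out: "\<And>v. v \<in> pverts G - W \<Longrightarrow> parcs G `` {v} = W"
    and inW: "\<And>w. w \<in> W \<Longrightarrow> parcs G `` {w} = pverts G - {w}"
  shows "digraph_iso G (S_graph n k)"
proof -
  interpret pair_graph G by fact
  have finW: "finite W" using finite_subset[OF assms(3) pair_finite_verts] .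
  obtain g where g: "bij_betw g W {..<k}"
    using finite_same_card_bij[OF finW, of "{..<k}"] assms(4) by auto
  have "card (pverts G - W) = n - k" using assms(2-4) finW by (simp add: card_Diff_subset)
  then obtain h where h: "bij_betw h (pverts G - W) {..<n - k}"
    using finite_same_card_bij[of "pverts G - W" "{..<n - k}"] pair_finite_verts by auto
  define f where "f v = (if v \<in> W then Inl (g v) else Inr (h v))" for v
  have gW: "inj_on g W" "g ` W = {..<k}" and hW: "inj_on h (pverts G - W)" "h ` (pverts G - W) = {..<n - k}"
    using g h by (auto simp: bij_betw_def)
  have arcs: "(v, w) \<in> parcs G \<longleftrightarrow> v \<in> pverts G \<and> w \<in> pverts G \<and> v \<noteq> w \<and> (v \<in> W \<or> w \<in> W)" for v w
  proof (cases "v \<in> pverts G")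
    case True
    have "(v, w) \<in> parcs G \<longleftrightarrow> w \<in> parcs G `` {v}" by simp
    then show ?thesis using out[of v] inW[of v] True assms(3) by (cases "v \<in> W") auto
  qed (use wellformed' in blast)
  show ?thesis
  proof (rule digraph_isoI)
    show "pair_wf_digraph G" by unfold_locales
    show inj: "inj_on f (pverts G)"
      using gW(1) hW(1) by (auto simp: f_def inj_on_def)
    show verts: "pverts (S_graph n k) = f ` pverts G"
    proof -
      have "f ` pverts G = f ` W \<union> f ` (pverts G - W)" using assms(3) by blast
      also have "f ` W = Inl ` {..<k}" using gW(2) by (auto simp: f_def image_iff)
      also have "f ` (pverts G - W) = Inr ` {..<n - k}" unfolding hW(2)[symmetric] image_image
        by (rule image_cong) (auto simp: f_def)
      finally show ?thesis by (auto simp: S_graph_simps)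
    qed
    have S_arcs: "(a, b) \<in> parcs (S_graph n k) \<longleftrightarrow>
        a \<in> f ` pverts G \<and> b \<in> f ` pverts G \<and> a \<noteq> b \<and> (isl a \<or> isl b)" for a b
      unfolding verts[symmetric] by (cases a; cases b) (auto simp: S_graph_simps)
    have isl_f: "isl (f v) \<longleftrightarrow> v \<in> W" for v by (simp add: f_def)
    have f_eq: "f v = f w \<longleftrightarrow> v = w" if "v \<in> pverts G" "w \<in> pverts G" for v w
      using inj that by (rule inj_on_eq_iff)
    show "parcs (S_graph n k) = map_prod f f ` parcs G"
    proof (intro equalityI subrelI)
      fix a b assume "(a, b) \<in> parcs (S_graph n k)"
      then obtain v w where vw: "v \<in> pverts G" "w \<in> pverts G" "a = f v" "b = f w"
        and "f v \<noteq> f w" "v \<in> W \<or> w \<in> W"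
        unfolding S_arcs by (auto simp: isl_f)
      then have "(v, w) \<in> parcs G" using arcs[of v w] by blast
      then show "(a, b) \<in> map_prod f f ` parcs G" using vw(3,4) by force
    next
      fix a b assume "(a, b) \<in> map_prod f f ` parcs G"
      then obtain v w where vw: "(v, w) \<in> parcs G" "a = f v" "b = f w" by auto
      then show "(a, b) \<in> parcs (S_graph n k)"
        using arcs[of v w] f_eq[of v w] by (simp add: S_arcs isl_f)
    qed
  qed
qed

theorem theorem1p2:
  fixes G :: "'a pair_pre_digraph" and k n :: nat
  assumes "k \<ge> 2"
    and "n > 2 * (k + 2) ^ 4"
    and "pair_graph G"
    and "card (pverts G) = n"
    and "largest_eigenvalue G \<ge> largest_eigenvalue (S_graph n k)"
    and "\<not> digraph_iso G (S_graph n k)"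
  shows "\<forall>T :: 'b pair_pre_digraph.
           undirected_tree T \<and> card (pverts T) = 2 * k + 2 \<and> diam T \<le> 4
             \<longrightarrow> contains_subgraph G T"
proof (intro allI impI)
  fix T :: "'b pair_pre_digraph"
  assume T: "undirected_tree T \<and> card (pverts T) = 2 * k + 2 \<and> diam T \<le> 4"
  interpret G: pair_graph G by fact
  have "pair_graph T" using T by (simp add: undirected_tree_def)
  then interpret T: pair_graph T .
  obtain c A B p where VT: "pverts T = insert c (A \<union> B)" and tree: "c \<notin> A" "c \<notin> B" "A \<inter> B = {}" "p ` B \<subseteq> A"
    and ET: "parcs T = {(c, a) | a. a \<in> A} \<union> {(a, c) | a. a \<in> A} \<union> {(p b, b) | b. b \<in> B} \<union> {(b, p b) | b. b \<in> B}"
    by (rule undirected_tree_two_levels[of T], use T in blast, use T in blast, rule that)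
  have finAB: "finite A" "finite B" using T.pair_finite_verts VT by auto
  then have card_AB: "card A + card B = 2 * k + 1"
    using T VT tree by (simp add: card_Un_disjoint)
  have sym: "sym (parcs G)" using G.pair_sym_arcs unfolding symmetric_def by simp
  have kn: "k < n"
  proof -
    have "k + 2 \<le> (k + 2) ^ 4" by (rule self_le_power) simp_all
    with assms(2) show ?thesis by linarith
  qed
  define l where "l = largest_eigenvalue G"
  \<comment> \<open>\<open>t\<close> is the larger root of the quadratic in
    \<open>S_graph_eigenvalue\<close>, and \<open>d\<close> the square root of its
    discriminant.\<close>
  define d where "d = sqrt ((real k - 1)\<^sup>2 + 4 * real k * (real n - real k))"
  define t where "t = ((real k - 1) + d) / 2"
  have d: "d\<^sup>2 = (real k - 1)\<^sup>2 + 4 * real k * (real n - real k)" "0 \<le> d"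
    using kn by (simp_all add: d_def)
  have t_pos: "0 < t" using d(2) assms(1) by (simp add: t_def)
  have t_sq: "t\<^sup>2 = (real k - 1) * t + real k * (real n - real k)"
    using d(1) by (simp add: t_def power2_eq_square field_simps)
  have t_le: "t \<le> l"
    using S_graph_eigenvalue[OF _ _ t_pos t_sq] assms(1,5) kn by (simp add: l_def)
  have "t * (t - (real k - 1)) = real k * (real n - real k)" using t_sq by (simp add: power2_eq_square algebra_simps)
  then have "0 \<le> t * (t - (real k - 1))" using kn by simp
  then have "0 \<le> t - (real k - 1)" using t_pos by (simp add: zero_le_mult_iff)
  \<comment> \<open>Both factors are nonnegative and grow with \<open>t\<close>, so the quadratic
    bound passes from \<open>t\<close> to \<open>l\<close>.\<close>
  then have "t * (t - (real k - 1)) \<le> l * (l - (real k - 1))" using t_le t_pos by (intro mult_mono) auto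
  then have l_sq: "(real k - 1) * l + real k * (real n - real k) \<le> l\<^sup>2"
    using t_sq by (simp add: power2_eq_square algebra_simps)
  have nonempty: "pverts G \<noteq> {}" using assms(4) kn by auto
  have l_nonneg: "0 \<le> largest_eigenvalue G" using t_le t_pos by (simp add: l_def)
  obtain y u where y: "\<And>v. 0 \<le> y v" "\<And>v. y v \<le> 1" "u \<in> pverts G" "y u = 1"
    "\<And>v. v \<in> pverts G \<Longrightarrow> l * y v \<le> (\<Sum>w\<in>parcs G `` {v}. y w)"
    by (rule largest_eigenvalue_subinvariant[OF assms(3) nonempty l_nonneg, folded l_def], rule that)
  show "contains_subgraph G T"
  proof (rule ccontr)
    assume nosub: "\<not> contains_subgraph G T"
    \<comment> \<open>An injection respecting the tree edges would exhibit \<open>T\<close> in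
      \<open>G\<close>, so \<open>nosub\<close> supplies \<open>no_embedding\<close>.\<close>
    interpret spectral_tree_free "pverts G" "parcs G" n k c A B p y l
    proof
      show "irrefl (parcs G)" using G.pair_no_loops by (force simp: irrefl_def)
      show "parcs G \<subseteq> pverts G \<times> pverts G" using G.wellformed' by auto
      show False if f: "inj_on f (insert c (A \<union> B))" "f ` insert c (A \<union> B) \<subseteq> pverts G"
        "\<forall>a\<in>A. (f c, f a) \<in> parcs G" "\<forall>b\<in>B. (f (p b), f b) \<in> parcs G" for f
      proof -
        have "contains_subgraph G T"
        proof (rule contains_subgraphI)
          show "pair_wf_digraph G" "pair_wf_digraph T" by unfold_locales
          show "inj_on f (pverts T)" "f ` pverts T \<subseteq> pverts G" using f VT by auto
          show "(f x, f z) \<in> parcs G" if "(x, z) \<in> parcs T" for x z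
            using that f(3,4) symD[OF sym] unfolding ET by auto
        qed
        with nosub show False by simp
      qed
    qed (use assms y tree finAB card_AB sym l_sq t_le t_pos G.pair_finite_verts in auto)
    obtain W where "W \<subseteq> pverts G" "card W = k"
      "\<And>v. v \<in> pverts G - W \<Longrightarrow> parcs G `` {v} = W" "\<And>w. w \<in> W \<Longrightarrow> parcs G `` {w} = pverts G - {w}"
      using graph_structure[OF y(3,4)] by blast
    then have "digraph_iso G (S_graph n k)" using assms(3,4) by (intro join_structure_iso_S_graph)
    with assms(6) show False by simp
  qed
qed

end
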